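(* Let $P$ and $Q$ be non-negative integers with $P$ even, with binary expansions $P=a_{n+1}a_n\cdots a_1$ and $Q=b_{n+1}b_n\cdots b_1$ ($a_1,b_1$ the least significant bits). If there exists $i$ with $1\le i\le n$ such that $a_{i+1}=b_i=1$, then there is no pair $(X,Y)$ of non-negative integers with $\mathrm{CVT}(X,Y)=P$ and $\mathrm{XOR}(X,Y)=Q$; in particular $(P,Q)$ is a leaf node of the CVT-XOR Tree with root $(0,P+Q)$.
   Context: For non-negative integers $X,Y$ written in binary, $\mathrm{XOR}(X,Y)$ is their bitwise exclusive or, and $\mathrm{CVT}(X,Y)=2\cdot(X \mathbin{\mathrm{AND}} Y)$ (bitwise AND shifted one position left, so bit $i+1$ of $\mathrm{CVT}(X,Y)$ is the AND of bit $i$ of $X$ and bit $i$ of $Y$, and bit $1$ is $0$). Define $f(X,Y)=(\mathrm{CVT}(X,Y),\mathrm{XOR}(X,Y))$, which preserves $X+Y$. The CVT-XOR Tree with root $(0,N)$ has as nodes the pairs $(X,Y)$ of non-negative integers with $X+Y=N$, the parent of a non-root node $(X,Y)$ being $f(X,Y)$; a leaf node is a node which is $f(X,Y)$ for no pair $(X,Y)$. *)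

theory Defs
  imports Main
begin

unbundle bit_operations_syntax

definition CVT :: "nat \<Rightarrow> nat \<Rightarrow> nat" where
  "CVT X Y = 2 * (X AND Y)"

definition cvt_xor_step :: "nat \<times> nat \<Rightarrow> nat \<times> nat" where
  "cvt_xor_step = (\<lambda>(X, Y). (CVT X Y, X XOR Y))"

lemma CVT_plus_xor: "CVT X Y + (X XOR Y) = X + Y"
proof (induction X arbitrary: Y rule: less_induct)
  case (less X)
  show ?case
  proof (cases "X = 0")
    case True
    then show ?thesis by (simp add: CVT_def)
  next
    case False
    then have "CVT (X div 2) (Y div 2) + (X div 2 XOR Y div 2) = X div 2 + Y div 2"
      by (intro less) simp
    then show ?thesis
      unfolding CVT_def and_rec [of X Y] xor_rec [of X Y]
      by (auto simp: of_bool_def split: if_splits) presburger+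
  qed
qed

record 'v parent_tree =
  root :: 'v
  nodes :: "'v set"
  parent :: "'v \<Rightarrow> 'v"

text \<open>
  The field \<open>parent\<close> is meaningful on the nodes other than the root; the root
  \<open>(0, N)\<close> itself is a fixed point of \<open>cvt_xor_step\<close>.
\<close>

definition cvt_xor_tree :: "nat \<Rightarrow> (nat \<times> nat) parent_tree" where
  "cvt_xor_tree N =
    \<lparr> root = (0, N), nodes = {(X, Y). X + Y = N}, parent = cvt_xor_step \<rparr>"

text \<open>
  Preimages under \<open>parent\<close> are not restricted to \<open>nodes T\<close>. For \<open>cvt_xor_tree N\<close> this
  makes no difference: by \<open>CVT_plus_xor\<close>, every preimage of a node is a node.
\<close>

definition leaf_node :: "'v parent_tree \<Rightarrow> 'v \<Rightarrow> bool" where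
  "leaf_node T v \<longleftrightarrow> v \<in> nodes T \<and> (\<nexists>u. parent T u = v)"

end

theory Submission
  imports Defs
begin

text \<open>A carry and a sum bit exclude each other: a 1 in position j+1 of \<open>CVT X Y\<close>
  means that X and Y both have a 1 in position j, and then \<open>X XOR Y\<close> has a 0 there. The
  hypothesis asks for both at once. \<open>bit_CVT_Suc_iff\<close> supplies the carry half; the
  digit-sum lemmas translate the given expansions into statements about \<open>bit\<close>.\<close>

lemma bit_sum_digits_iff:
  fixes c :: "nat \<Rightarrow> nat"
  assumes "\<And>k. k < m \<Longrightarrow> c k \<in> {0, 1}"
  shows "bit (\<Sum>k<m. c k * 2 ^ k) j \<longleftrightarrow> j < m \<and> c j = 1"
  using assms
proof (induction m arbitrary: c j)
  case 0
  then show ?case by simp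
next
  case (Suc m)
  have digit: "c 0 \<in> {0, 1}" using Suc.prems by blast
  \<comment> \<open>Splitting off the lowest digit fits the recursion \<open>bit_Suc\<close>; what
    remains is the expansion of the shifted digit sequence, hence the induction with
    \<open>c\<close> arbitrary.\<close>
  have shift: "(\<Sum>k<Suc m. c k * 2 ^ k) = c 0 + 2 * (\<Sum>k<m. c (Suc k) * 2 ^ k)"
    by (simp add: sum.lessThan_Suc_shift sum_distrib_left mult.left_commute del: sum.lessThan_Suc)
  show ?case
  proof (cases j)
    case 0
    then show ?thesis unfolding shift using digit by (auto simp: bit_0)
  next
    case (Suc j')
    have "bit (\<Sum>k<m. c (Suc k) * 2 ^ k) j' \<longleftrightarrow> j' < m \<and> c (Suc j') = 1"
      using Suc.prems by (intro Suc.IH) auto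
    moreover have "(c 0 + 2 * (\<Sum>k<m. c (Suc k) * 2 ^ k)) div 2 = (\<Sum>k<m. c (Suc k) * 2 ^ k)"
      using digit by auto
    ultimately show ?thesis unfolding shift Suc by (simp add: bit_Suc)
  qed
qed

text \<open>Bridges two numberings: digits are counted from 1, bits from 0, so digit
  \<open>Suc j\<close> is bit \<open>j\<close>.\<close>

lemma bit_sum_digits_from_1_iff:
  fixes c :: "nat \<Rightarrow> nat"
  assumes "\<forall>i\<in>{1..m}. c i \<in> {0, 1}"
  shows "bit (\<Sum>i = 1..m. c i * 2 ^ (i - 1)) j \<longleftrightarrow> j < m \<and> c (Suc j) = 1"
proof -
  have "(\<Sum>i = 1..m. c i * 2 ^ (i - 1)) = (\<Sum>k<m. c (Suc k) * 2 ^ k)"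
    by (simp add: sum.atLeast1_atMost_eq)
  moreover have "bit (\<Sum>k<m. c (Suc k) * 2 ^ k) j \<longleftrightarrow> j < m \<and> c (Suc j) = 1"
    using assms by (intro bit_sum_digits_iff) auto
  ultimately show ?thesis by simp
qed

lemma bit_CVT_Suc_iff: "bit (CVT X Y) (Suc j) \<longleftrightarrow> bit X j \<and> bit Y j"
  by (simp add: CVT_def bit_Suc bit_and_iff)

theorem theorem3:
  fixes P Q n :: nat and a b :: "nat \<Rightarrow> nat"
  assumes "even P"
    and "\<forall>i\<in>{1..n+1}. a i \<in> {0, 1}" and "P = (\<Sum>i = 1..n+1. a i * 2 ^ (i - 1))"
    and "\<forall>i\<in>{1..n+1}. b i \<in> {0, 1}" and "Q = (\<Sum>i = 1..n+1. b i * 2 ^ (i - 1))"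
    and "\<exists>i. 1 \<le> i \<and> i \<le> n \<and> a (i + 1) = 1 \<and> b i = 1"
  shows "(\<nexists>X Y. CVT X Y = P \<and> X XOR Y = Q) \<and> leaf_node (cvt_xor_tree (P + Q)) (P, Q)"
proof -
  obtain i where i: "1 \<le> i" "i \<le> n" "a (i + 1) = 1" "b i = 1"
    using assms(6) by blast
  \<comment> \<open>\<open>j\<close> is the bit position of digit \<open>i\<close>; it exists
    because i \<ge> 1.\<close>
  then obtain j where j: "i = Suc j"
    by (cases i) auto
  have "bit P (Suc j)"
    unfolding assms(3) bit_sum_digits_from_1_iff [OF assms(2)] using i j by simp
  moreover have "bit Q j"
    unfolding assms(5) bit_sum_digits_from_1_iff [OF assms(4)] using i j by simp
  \<comment> \<open>Bit \<open>Suc j\<close> of P makes bit \<open>j\<close> of X and of Y equal to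
    1, so their XOR vanishes there, against \<open>bit Q j\<close>.\<close>
  ultimately have no_preimage: "\<not> (CVT X Y = P \<and> X XOR Y = Q)" for X Y
    by (auto simp: bit_CVT_Suc_iff bit_xor_iff)
  then show ?thesis
    by (auto simp: leaf_node_def cvt_xor_tree_def cvt_xor_step_def)
qed

end
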